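(* Let $n\ge 2$ be an integer. For every $f\in P_n$, the tangent map $dM:\mathbb{C}^n\to\mathbb{C}^n$ at the point $f$ has rank $n-1$. Moreover, under the identification of the tangent space $\mathbb{C}^n$ to $P_n$ at $f$ with the space of complex polynomials of degree $\le n-1$, the kernel of $dM$ at $f$ always contains $f'(x)$ and coincides with the one-dimensional subspace $\mathbb{C}\cdot f'(x)$.
   Context: $P_n\subset\mathbb{C}^n$ is the $n$-dimensional complex manifold of all monic complex polynomials $f(x)=x^n+\sum_{i=0}^{n-1}a_ix^i$ of degree $n$ without multiple roots, with coordinates $a=(a_0,\dots,a_{n-1})$. Locally on $P_n$, order the roots $\alpha_1,\dots,\alpha_n$ of $f$ so that each $\alpha_i$ is a smooth (holomorphic) single-valued function of $a$ (possible by the Implicit Function Theorem). The locally defined map $M$ is $$M: a=(a_0,\dots,a_{n-1})\mapsto (f'(\alpha_1),\dots,f'(\alpha_n))\in\mathbb{C}^n,$$ and $dM:\mathbb{C}^n\to\mathbb{C}^n$ denotes its tangent map (differential with respect to $a$) at $f$. The tangent space $\mathbb{C}^n$ to $P_n$ is identified with the space of all complex polynomials of degree $\le n-1$ by letting $p(x)=\sum_{i=0}^{n-1}c_ix^i$ correspond to the tangent vector $(c_0,\dots,c_{n-1})$. *)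

theory Defs
  imports "HOL-Analysis.Analysis" "HOL-Computational_Algebra.Fundamental_Theorem_Algebra"
begin

text \<open>
  The space of coefficient vectors is \<open>complex ^ 'n\<close> with \<open>n = CARD('n)\<close>.  Its coordinates are
  indexed by the exponents \<open>0, ..., n - 1\<close>, so the elements of the index type are numbered by a
  fixed bijection onto \<open>{..<CARD('n)}\<close>.
\<close>

definition coord_index :: "'n::finite \<Rightarrow> nat" where
  "coord_index = to_nat_on UNIV"

lemma bij_coord_index: "bij_betw (coord_index :: 'n::finite \<Rightarrow> nat) UNIV {..<CARD('n)}"
  unfolding coord_index_def by (rule to_nat_on_finite) simp

definition poly_of_coords :: "complex ^ 'n \<Rightarrow> complex poly" where
  "poly_of_coords c = (\<Sum>i\<in>UNIV. monom (c $ i) (coord_index i))"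

definition monic_of_coords :: "complex ^ 'n \<Rightarrow> complex poly" where
  "monic_of_coords a = monom 1 CARD('n) + poly_of_coords a"

text \<open>
  \<open>coords\<close> reads off the coefficients below degree \<open>n\<close>.  It is both the coordinate chart on the monic
  polynomials of degree \<open>n\<close> (inverse to \<open>monic_of_coords\<close>) and the identification of the polynomials
  of degree at most \<open>n - 1\<close> with tangent vectors (inverse to \<open>poly_of_coords\<close>).
\<close>

definition coords :: "complex poly \<Rightarrow> complex ^ 'n" where
  "coords p = (\<chi> i. coeff p (coord_index i))"

definition P_space :: "nat \<Rightarrow> complex poly set" where
  "P_space n = {f. lead_coeff f = 1 \<and> degree f = n \<and> rsquarefree f}"

text \<open>Holomorphy in several variables: real (Frechet) differentiable with complex linear derivative.\<close>

definition holomorphic_map_on :: "(complex ^ 'n \<Rightarrow> complex ^ 'm) \<Rightarrow> (complex ^ 'n) set \<Rightarrow> bool" where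
  "holomorphic_map_on F U \<longleftrightarrow>
     (\<forall>a\<in>U. \<exists>D. (F has_derivative D) (at a) \<and> Vector_Spaces.linear (*s) (*s) D)"

definition local_root_ordering :: "(complex ^ 'n) set \<Rightarrow> (complex ^ 'n \<Rightarrow> complex ^ 'n) \<Rightarrow> bool" where
  "local_root_ordering U \<alpha> \<longleftrightarrow>
     open U \<and> monic_of_coords ` U \<subseteq> P_space CARD('n) \<and> holomorphic_map_on \<alpha> U \<and>
     (\<forall>a\<in>U. bij_betw (\<lambda>i. \<alpha> a $ i) UNIV {x. poly (monic_of_coords a) x = 0})"

definition root_deriv_map :: "(complex ^ 'n \<Rightarrow> complex ^ 'n) \<Rightarrow> complex ^ 'n \<Rightarrow> complex ^ 'n" where
  "root_deriv_map \<alpha> a = (\<chi> i. poly (pderiv (monic_of_coords a)) (\<alpha> a $ i))"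

definition tangent_map ::
    "(complex ^ 'n \<Rightarrow> complex ^ 'n) \<Rightarrow> complex ^ 'n \<Rightarrow> complex ^ 'n \<Rightarrow> complex ^ 'n" where
  "tangent_map \<alpha> a = frechet_derivative (root_deriv_map \<alpha>) (at a)"


lemma coeff_poly_of_coords [simp]:
  fixes c :: "complex ^ 'n"
  shows "coeff (poly_of_coords c) (coord_index i) = c $ i"
proof -
  have "coord_index j = coord_index i \<longleftrightarrow> j = i" for j :: 'n
    using bij_coord_index[where 'n='n] by (auto simp: bij_betw_def inj_on_def)
  then show ?thesis by (simp add: poly_of_coords_def coeff_sum)
qed

lemma coord_index_less: "coord_index (i :: 'n::finite) < CARD('n)"
  using bij_coord_index[where 'n='n] by (auto simp: bij_betw_def)

lemma coeff_poly_of_coords_ge: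
  fixes c :: "complex ^ 'n"
  assumes "k \<ge> CARD('n)"
  shows "coeff (poly_of_coords c) k = 0"
proof -
  have "coord_index i \<noteq> k" for i :: 'n
    using coord_index_less[of i] assms by linarith
  then show ?thesis by (simp add: poly_of_coords_def coeff_sum)
qed

lemma coords_poly_of_coords [simp]: "coords (poly_of_coords c) = c"
  by (simp add: coords_def vec_eq_iff)

lemma coords_monic_of_coords [simp]:
  fixes c :: "complex ^ 'n"
  shows "coords (monic_of_coords c) = c"
proof -
  have "CARD('n) \<noteq> coord_index i" for i :: 'n
    using coord_index_less[of i] by simp
  then show ?thesis by (simp add: coords_def monic_of_coords_def vec_eq_iff)
qed

lemma poly_of_coords_coords:
  assumes "degree p < CARD('n)"
  shows "poly_of_coords (coords p :: complex ^ 'n) = p"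
proof (rule poly_eqI)
  fix k
  show "coeff (poly_of_coords (coords p :: complex ^ 'n)) k = coeff p k"
  proof (cases "k < CARD('n)")
    case True
    then obtain i :: 'n where "k = coord_index i"
      using bij_coord_index[where 'n='n] by (metis bij_betw_apply bij_betw_inv_into bij_betw_inv_into_right lessThan_iff UNIV_I)
    then show ?thesis by (simp add: coords_def)
  next
    case False
    then show ?thesis
      using assms by (simp add: coeff_poly_of_coords_ge coeff_eq_0)
  qed
qed

lemma degree_monic_of_coords: "degree (monic_of_coords (a :: complex ^ 'n)) = CARD('n)"
  and lead_coeff_monic_of_coords: "lead_coeff (monic_of_coords (a :: complex ^ 'n)) = 1"
proof -
  have c: "coeff (monic_of_coords a) CARD('n) = 1"
    by (simp add: monic_of_coords_def coeff_poly_of_coords_ge)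
  have "coeff (monic_of_coords a) k = 0" if "k > CARD('n)" for k
    using that by (simp add: monic_of_coords_def coeff_poly_of_coords_ge)
  then have "degree (monic_of_coords a) \<le> CARD('n)"
    by (intro degree_le) auto
  moreover have "CARD('n) \<le> degree (monic_of_coords a)"
    by (rule le_degree) (simp add: c)
  ultimately show d: "degree (monic_of_coords a) = CARD('n)" by simp
  show "lead_coeff (monic_of_coords a) = 1" by (simp add: d c)
qed

lemma monic_of_coords_coords:
  assumes "f \<in> P_space CARD('n)"
  shows "monic_of_coords (coords f :: complex ^ 'n) = f"
proof (rule poly_eqI)
  fix k
  have f: "degree f = CARD('n)" "coeff f CARD('n) = 1"
    using assms by (auto simp: P_space_def)
  consider "k < CARD('n)" | "k = CARD('n)" | "k > CARD('n)" by linarith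
  then show "coeff (monic_of_coords (coords f :: complex ^ 'n)) k = coeff f k"
  proof cases
    case 1
    then obtain i :: 'n where "k = coord_index i"
      using bij_coord_index[where 'n='n] by (metis bij_betw_apply bij_betw_inv_into bij_betw_inv_into_right lessThan_iff UNIV_I)
    then show ?thesis using 1 by (simp add: monic_of_coords_def coords_def)
  qed (use f in \<open>auto simp: monic_of_coords_def coeff_poly_of_coords_ge coeff_eq_0\<close>)
qed

lemma poly_poly_of_coords: "poly (poly_of_coords c) x = (\<Sum>i\<in>UNIV. c $ i * x ^ coord_index i)"
  by (simp add: poly_of_coords_def poly_sum poly_monom)

lemma poly_monic_of_coords:
  "poly (monic_of_coords (a :: complex ^ 'n)) x = x ^ CARD('n) + (\<Sum>i\<in>UNIV. a $ i * x ^ coord_index i)"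
  by (simp add: monic_of_coords_def poly_monom poly_poly_of_coords)

lemma pderiv_sum_poly: "pderiv (\<Sum>i\<in>A. p i) = (\<Sum>i\<in>A. pderiv (p i :: complex poly))"
  by (induction A rule: infinite_finite_induct) (simp_all add: pderiv_add)

lemma poly_pderiv_monic_of_coords:
  "poly (pderiv (monic_of_coords (a :: complex ^ 'n))) x =
     of_nat CARD('n) * x ^ (CARD('n) - 1) +
     (\<Sum>i\<in>UNIV. of_nat (coord_index i) * a $ i * x ^ (coord_index i - 1))"
  by (simp add: monic_of_coords_def poly_of_coords_def pderiv_add pderiv_sum_poly pderiv_monom
      poly_sum poly_monom mult_ac)

lemma poly_monic_has_derivative:
  fixes p :: "(complex ^ 'n) \<times> complex"
  shows "((\<lambda>p. poly (monic_of_coords (fst p)) (snd p)) has_derivative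
     (\<lambda>h. poly (pderiv (monic_of_coords (fst p))) (snd p) * snd h
           + poly (poly_of_coords (fst h)) (snd p))) (at p)"
  unfolding poly_monic_of_coords poly_pderiv_monic_of_coords poly_poly_of_coords
  apply (rule has_derivative_eq_rhs)
   apply (rule derivative_eq_intros refl bounded_linear.has_derivative[OF bounded_linear_vec_nth])+
  apply (auto simp: fun_eq_iff algebra_simps sum.distrib sum_distrib_left)
  done

lemma simple_root_branch:
  fixes a :: "complex ^ 'n"
  assumes r: "poly (monic_of_coords a) r = 0" "poly (pderiv (monic_of_coords a)) r \<noteq> 0"
    and "e > 0"
  obtains V \<beta> where "open V" "a \<in> V"
    "\<And>b. b \<in> V \<Longrightarrow> \<beta> b \<in> ball r e \<and> poly (monic_of_coords b) (\<beta> b) = 0 \<and>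
       poly (pderiv (monic_of_coords b)) (\<beta> b) \<noteq> 0 \<and>
       (\<beta> has_derivative (\<lambda>h. - poly (poly_of_coords h) (\<beta> b) /
           poly (pderiv (monic_of_coords b)) (\<beta> b))) (at b)"
proof -
  define F :: "(complex ^ 'n) \<times> complex \<Rightarrow> (complex ^ 'n) \<times> complex"
    where "F p = (fst p, poly (monic_of_coords (fst p)) (snd p))" for p
  define q where "q p = poly (pderiv (monic_of_coords (fst p))) (snd p)"
    for p :: "(complex ^ 'n) \<times> complex"
  define L :: "(complex ^ 'n) \<times> complex \<Rightarrow> (complex ^ 'n) \<times> complex \<Rightarrow> (complex ^ 'n) \<times> complex"
    where "L p h = (fst h, q p * snd h + poly (poly_of_coords (fst h)) (snd p))" for p h
  have der: "(F has_derivative L p) (at p)" for p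
    unfolding F_def[abs_def] L_def[abs_def] q_def
    by (intro has_derivative_Pair poly_monic_has_derivative derivative_intros)
  have bl: "bounded_linear (L p)" for p
    using der by (rule has_derivative_bounded_linear)
  have bla [simp]: "blinfun_apply (Blinfun (L p)) = L p" for p
    using bl by (rule bounded_linear_Blinfun_apply)
  define U where "U = (UNIV :: (complex ^ 'n) set) \<times> ball r e"
  have U: "open U" "(a, r) \<in> U"
    using \<open>e > 0\<close> by (auto simp: U_def open_Times)
  have cont: "continuous_on U (\<lambda>p. Blinfun (L p))"
  proof (rule continuous_on_blinfun_componentwise)
    show "continuous_on U (\<lambda>p. blinfun_apply (Blinfun (L p)) i)" for i
      unfolding bla L_def q_def poly_pderiv_monic_of_coords poly_poly_of_coords
      by (intro continuous_intros)
  qed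
  define Inv :: "(complex ^ 'n) \<times> complex \<Rightarrow> (complex ^ 'n) \<times> complex"
    where "Inv h = (fst h, (snd h - poly (poly_of_coords (fst h)) r) / q (a, r))" for h
  have qne: "q (a, r) \<noteq> 0" using r by (simp add: q_def)
  have blI: "bounded_linear Inv"
  proof -
    have "linear Inv"
      by (rule linearI)
        (auto simp: Inv_def poly_poly_of_coords algebra_simps sum.distrib diff_divide_distrib
          add_divide_distrib scaleR_conv_of_real[where 'a=complex] sum_distrib_left)
    then show ?thesis by (simp add: linear_conv_bounded_linear)
  qed
  have inv: "Blinfun Inv o\<^sub>L Blinfun (L (a, r)) = id_blinfun"
    by (rule blinfun_eqI) (simp add: bounded_linear_Blinfun_apply[OF blI], simp add: Inv_def L_def qne)
  have der': "(F has_derivative blinfun_apply (Blinfun (L p))) (at p)" if "p \<in> U" for p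
    using der by simp
  obtain U' V g g' where UV: "open U'" "U' \<subseteq> U" "(a, r) \<in> U'" "open V" "F (a, r) \<in> V"
      "homeomorphism U' V F g"
    and g: "\<And>y. y \<in> V \<Longrightarrow> (g has_derivative g' y) (at y)"
      "\<And>y. y \<in> V \<Longrightarrow> bij (blinfun_apply (Blinfun (L (g y))))"
    using inverse_function_theorem[OF U(1) der' cont U(2) inv] by metis
  define W where "W = (\<lambda>b. (b, 0 :: complex)) -` V"
  define \<beta> where "\<beta> b = snd (g (b, 0))" for b
  have oW: "open W"
    unfolding W_def using \<open>open V\<close> by (intro open_vimage continuous_intros)
  have "a \<in> W" using UV(5) r by (simp add: W_def F_def)
  moreover have "\<beta> b \<in> ball r e \<and> poly (monic_of_coords b) (\<beta> b) = 0 \<and>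
       poly (pderiv (monic_of_coords b)) (\<beta> b) \<noteq> 0 \<and>
       (\<beta> has_derivative (\<lambda>h. - poly (poly_of_coords h) (\<beta> b) /
           poly (pderiv (monic_of_coords b)) (\<beta> b))) (at b)" if "b \<in> W" for b
  proof -
    have gF: "g (b', 0) = (b', \<beta> b') \<and> poly (monic_of_coords b') (\<beta> b') = 0" if "b' \<in> W" for b'
    proof -
      have "F (g (b', 0)) = (b', 0)"
        using UV(6) that by (auto simp: W_def homeomorphism_def)
      then show ?thesis by (auto simp: F_def \<beta>_def prod_eq_iff)
    qed
    have bV: "(b, 0) \<in> V" using that by (simp add: W_def)
    then have "g (b, 0) \<in> U" using UV(2,6) by (auto simp: homeomorphism_def)
    then have 1: "\<beta> b \<in> ball r e" by (auto simp: U_def \<beta>_def)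
    have 2: "q (b, \<beta> b) \<noteq> 0"
    proof
      assume q0: "q (b, \<beta> b) = 0"
      have "L (b, \<beta> b) (0, 1) = L (b, \<beta> b) (0, 0)"
        by (simp add: L_def q0)
      moreover have "inj (L (b, \<beta> b))"
        using g(2)[OF bV] gF[OF that] by (simp add: bij_is_inj)
      ultimately have "(0 :: complex ^ 'n, 1 :: complex) = (0, 0)"
        by (rule injD[rotated])
      then show False by simp
    qed
    have "((\<lambda>b. (b, 0 :: complex)) has_derivative (\<lambda>h. (h, 0))) (at b)"
      by (intro derivative_intros)
    from has_derivative_compose[OF this g(1)[OF bV]]
    have dg: "((\<lambda>b. g (b, 0)) has_derivative (\<lambda>h. g' (b, 0) (h, 0))) (at b)" .
    define D where "D h = snd (g' (b, 0) (h, 0))" for h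
    have dB: "(\<beta> has_derivative D) (at b)"
      unfolding \<beta>_def[abs_def] D_def[abs_def] by (rule has_derivative_snd[OF dg])
    have "((\<lambda>b. (b, \<beta> b)) has_derivative (\<lambda>h. (h, D h))) (at b)"
      by (intro has_derivative_Pair has_derivative_ident dB)
    from has_derivative_compose[OF this, where g="\<lambda>p. poly (monic_of_coords (fst p)) (snd p)",
        OF poly_monic_has_derivative]
    have "((\<lambda>b. poly (monic_of_coords b) (\<beta> b)) has_derivative
       (\<lambda>h. q (b, \<beta> b) * D h + poly (poly_of_coords h) (\<beta> b))) (at b)"
      by (simp add: q_def)
    moreover have "((\<lambda>b. poly (monic_of_coords b) (\<beta> b)) has_derivative (\<lambda>h. 0)) (at b)"
      by (rule has_derivative_transform_within_open[OF has_derivative_const[of 0] oW that])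
        (use gF in auto)
    ultimately have "(\<lambda>h. q (b, \<beta> b) * D h + poly (poly_of_coords h) (\<beta> b)) = (\<lambda>h. 0)"
      by (rule has_derivative_unique)
    then have "q (b, \<beta> b) * D h = - poly (poly_of_coords h) (\<beta> b)" for h
      by (metis add_eq_0_iff2 eq_neg_iff_add_eq_0)
    then have "D h = - poly (poly_of_coords h) (\<beta> b) / q (b, \<beta> b)" for h
      using 2 by (metis nonzero_mult_div_cancel_left)
    then have "D = (\<lambda>h. - poly (poly_of_coords h) (\<beta> b) / q (b, \<beta> b))" by blast
    with 1 2 dB gF[OF that] show ?thesis by (simp add: q_def)
  qed
  ultimately show ?thesis using that oW by blast
qed

text \<open>
  Local orderings of the roots exist around every point of \<open>P_space\<close>, so a statement quantified over
  all of them is not vacuous.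
\<close>

lemma ex_local_root_ordering:
  assumes f: "f \<in> P_space CARD('n)"
  obtains U and \<alpha> :: "complex ^ 'n \<Rightarrow> complex ^ 'n"
  where "local_root_ordering U \<alpha>" "coords f \<in> U"
proof -
  define a where "a = (coords f :: complex ^ 'n)"
  have fa: "monic_of_coords a = f"
    unfolding a_def by (rule monic_of_coords_coords[OF f])
  have sf: "rsquarefree f" and f0: "f \<noteq> 0" and deg: "degree f = CARD('n)"
    using f by (auto simp: P_space_def)
  have "card {x. poly f x = 0} = CARD('n)"
  proof -
    have fin: "finite {x. poly f x = 0}" by (rule poly_roots_finite[OF f0])
    have "degree f = degree (smult (lead_coeff f) (\<Prod>z | poly f z = 0. [:- z, 1:]))"
      using complex_poly_decompose_rsquarefree[OF sf] by simp
    also have "\<dots> = (\<Sum>z | poly f z = 0. degree [:- z, 1:])"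
      using f0 by (simp add: degree_prod_eq_sum_degree)
    finally show ?thesis using deg by simp
  qed
  then obtain r :: "'n \<Rightarrow> complex" where r: "bij_betw r UNIV {x. poly f x = 0}"
    using finite_same_card_bij[of "UNIV :: 'n set" "{x. poly f x = 0}"] poly_roots_finite[OF f0]
    by auto
  have r0: "poly f (r i) = 0" for i
    using r by (auto simp: bij_betw_def)
  have r1: "poly (pderiv f) (r i) \<noteq> 0" for i
    using r0 sf rsquarefree_roots by blast
  obtain e where e: "e > 0" "\<And>i j. i \<noteq> j \<Longrightarrow> dist (r i) (r j) \<ge> 2 * e"
  proof -
    define S where "S = insert 1 ((\<lambda>(i, j). dist (r i) (r j)) ` {(i, j). i \<noteq> j})"
    have S: "finite S" "S \<noteq> {}" by (auto simp: S_def)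
    have "x > 0" if "x \<in> S" for x
      using that r by (auto simp: S_def bij_betw_def inj_on_def)
    then have "Min S > 0" using S by simp
    moreover have "dist (r i) (r j) \<ge> Min S" if "i \<noteq> j" for i j
      using that S by (intro Min_le) (auto simp: S_def)
    ultimately show ?thesis using that[of "Min S / 2"] by simp
  qed
  define good where "good = (\<lambda>i V \<beta>. open V \<and> a \<in> V \<and> (\<forall>b\<in>V. \<beta> b \<in> ball (r i) e \<and>
       poly (monic_of_coords b) (\<beta> b) = 0 \<and> poly (pderiv (monic_of_coords b)) (\<beta> b) \<noteq> 0 \<and>
       (\<beta> has_derivative (\<lambda>h. - poly (poly_of_coords h) (\<beta> b) /
           poly (pderiv (monic_of_coords b)) (\<beta> b))) (at b)))"
  have "\<exists>V \<beta>. good i V \<beta>" for i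
    using simple_root_branch[of a "r i" e] r0 r1 e(1) unfolding fa good_def by metis
  then obtain V \<beta> where V: "\<And>i. good i (V i) (\<beta> i)" by metis
  define U where "U = (\<Inter>i. V i)"
  define \<alpha> where "\<alpha> b = (\<chi> i. \<beta> i b)" for b
  have U: "open U" "a \<in> U" using V by (auto simp: U_def good_def)
  have G: "\<beta> i b \<in> ball (r i) e" "poly (monic_of_coords b) (\<beta> i b) = 0"
       "poly (pderiv (monic_of_coords b)) (\<beta> i b) \<noteq> 0"
       "(\<beta> i has_derivative (\<lambda>h. - poly (poly_of_coords h) (\<beta> i b) /
           poly (pderiv (monic_of_coords b)) (\<beta> i b))) (at b)" if "b \<in> U" for i b
    using V[of i] that by (auto simp: U_def good_def)
  have bij: "bij_betw (\<lambda>i. \<alpha> b $ i) UNIV {x. poly (monic_of_coords b) x = 0}" if b: "b \<in> U" for b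
  proof -
    have inj: "inj (\<lambda>i. \<beta> i b)"
    proof (rule injI, rule ccontr)
      fix i j assume *: "\<beta> i b = \<beta> j b" "i \<noteq> j"
      have "dist (r i) (r j) \<le> dist (r i) (\<beta> i b) + dist (r j) (\<beta> j b)"
        using *(1) by (metis dist_triangle2)
      also have "\<dots> < 2 * e" using G(1)[OF b, of i] G(1)[OF b, of j] by simp
      finally show False using e(2)[OF *(2)] by simp
    qed
    have ne: "monic_of_coords b \<noteq> 0"
      using lead_coeff_monic_of_coords[of b] by auto
    have fin: "finite {x. poly (monic_of_coords b) x = 0}"
      by (rule poly_roots_finite[OF ne])
    have sub: "range (\<lambda>i. \<beta> i b) \<subseteq> {x. poly (monic_of_coords b) x = 0}"
      using G(2)[OF b] by auto
    have "card {x. poly (monic_of_coords b) x = 0} \<le> CARD('n)"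
      using card_poly_roots_bound[OF ne] by (simp add: degree_monic_of_coords)
    also have "\<dots> = card (range (\<lambda>i. \<beta> i b))"
      using inj by (simp add: card_image)
    finally have "range (\<lambda>i. \<beta> i b) = {x. poly (monic_of_coords b) x = 0}"
      using card_seteq[OF fin sub] by simp
    then show ?thesis using inj by (simp add: bij_betw_def \<alpha>_def)
  qed
  have "monic_of_coords b \<in> P_space CARD('n)" if b: "b \<in> U" for b
  proof -
    have "rsquarefree (monic_of_coords b)"
      unfolding rsquarefree_roots
    proof (intro allI notI, elim conjE)
      fix x assume x: "poly (monic_of_coords b) x = 0" "poly (pderiv (monic_of_coords b)) x = 0"
      then obtain i where "x = \<beta> i b"
        using bij[OF b] by (auto simp: bij_betw_def \<alpha>_def)
      with x G(3)[OF b] show False by blast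
    qed
    then show ?thesis
      by (simp add: P_space_def degree_monic_of_coords lead_coeff_monic_of_coords[simplified degree_monic_of_coords])
  qed
  moreover have "holomorphic_map_on \<alpha> U"
    unfolding holomorphic_map_on_def
  proof
    fix b assume b: "b \<in> U"
    define D :: "complex ^ 'n \<Rightarrow> complex ^ 'n" where "D h = (\<chi> i. - poly (poly_of_coords h) (\<beta> i b) /
           poly (pderiv (monic_of_coords b)) (\<beta> i b))" for h
    have "(\<alpha> has_derivative D) (at b)"
    proof -
      have "((\<lambda>b. \<Sum>i\<in>UNIV. axis i (\<beta> i b)) has_derivative (\<lambda>h. \<Sum>i\<in>UNIV. axis i (D h $ i))) (at b)"
      proof (intro has_derivative_sum)
        fix i :: 'n
        have "linear (axis i :: complex \<Rightarrow> complex ^ 'n)"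
          by (rule linearI) (auto simp: axis_def vec_eq_iff)
        then have "bounded_linear (axis i :: complex \<Rightarrow> complex ^ 'n)"
          by (simp add: linear_conv_bounded_linear)
        from bounded_linear.has_derivative[OF this G(4)[OF b, of i]]
        show "((\<lambda>b. axis i (\<beta> i b) :: complex ^ 'n) has_derivative (\<lambda>h. axis i (D h $ i))) (at b)"
          by (simp add: D_def)
      qed
      moreover have "(\<Sum>i\<in>UNIV. axis i (x i)) = (\<chi> i. x i)" for x :: "'n \<Rightarrow> complex"
        by (simp add: vec_eq_iff axis_def)
      ultimately show ?thesis by (simp add: \<alpha>_def[abs_def])
    qed
    moreover have "Vector_Spaces.linear (*s) (*s) D"
      by unfold_locales
        (auto simp: D_def vec_eq_iff poly_poly_of_coords algebra_simps sum.distrib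
          add_divide_distrib diff_divide_distrib sum_distrib_left)
    ultimately show "\<exists>D. (\<alpha> has_derivative D) (at b) \<and> Vector_Spaces.linear (*s) (*s) D" by blast
  qed
  ultimately have "local_root_ordering U \<alpha>"
    using U bij by (auto simp: local_root_ordering_def)
  then show ?thesis using that U(2) a_def by blast
qed

end

theory Submission
  imports Defs
begin

text \<open>
  Write \<open>\<alpha>\<^sub>i\<close> for the roots of \<open>f\<close>.  Differentiating \<open>f(\<alpha>\<^sub>i) = 0\<close> in the direction of a polynomial \<open>p\<close>
  of degree less than \<open>n\<close> gives \<open>d\<alpha>\<^sub>i(p) = - p(\<alpha>\<^sub>i) / f'(\<alpha>\<^sub>i)\<close>, so the \<open>i\<close>-th component of \<open>dM(p)\<close> is
  \<open>p'(\<alpha>\<^sub>i) - f''(\<alpha>\<^sub>i) p(\<alpha>\<^sub>i) / f'(\<alpha>\<^sub>i)\<close> (lemma \<open>root_deriv_map_has_derivative\<close>).  Hence \<open>p\<close> lies in the kernel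
  exactly when \<open>p' f' - p f''\<close> vanishes at every root of \<open>f\<close>; this holds for \<open>p = f'\<close>.

  The converse is lemma \<open>smult_pderiv_if_vanishing\<close>.  Since \<open>f'\<close> has no zero among the roots, there is a
  polynomial \<open>b\<close> of degree \<open>d < n\<close> that agrees with \<open>p / f'\<close> at the roots, so \<open>p = b f' - f q\<close> for some
  \<open>q\<close> of degree less than \<open>n\<close>.  Inserting this into the kernel condition gives \<open>q = b'\<close> at the \<open>n\<close> roots,
  hence \<open>q = b'\<close> and \<open>p = b f' - f b'\<close>.  If \<open>d > 0\<close>, the coefficient of \<open>x\<^bsup>n + d - 1\<^esup>\<close> on the right is
  \<open>(n - d)\<close> times the product of the leading coefficients of \<open>b\<close> and \<open>f\<close>, which is not zero, although
  \<open>p\<close> has degree less than \<open>n\<close>.  So \<open>b\<close> is a constant \<open>c\<close> and \<open>p = c f'\<close>.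

  The kernel is therefore the line spanned by \<open>f'\<close>, and the rank is \<open>n - 1\<close> by rank and
  nullity (lemma \<open>dim_range_if_kernel_line\<close>).
\<close>

section \<open>Polynomials whose quotient by \<open>f'\<close> has vanishing derivative at the roots of \<open>f\<close>\<close>

lemma ex_interpolating_poly:
  fixes v :: "'a::field \<Rightarrow> 'a"
  assumes "finite A"
  shows "\<exists>b. (\<forall>x\<in>A. poly b x = v x) \<and> degree b \<le> card A - 1"
  using assms
proof (induction A)
  case empty
  then show ?case by (intro exI[of _ 0]) simp
next
  case (insert z A)
  then obtain b where b: "\<forall>x\<in>A. poly b x = v x" "degree b \<le> card A - 1" by blast
  define w where "w = (\<Prod>x\<in>A. [:- x, 1:])"
  define b' where "b' = b + smult ((v z - poly b z) / poly w z) w"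
  have w: "poly w x = 0 \<longleftrightarrow> x \<in> A" for x
    using insert.hyps by (auto simp: w_def poly_prod)
  have "degree w \<le> card A"
    unfolding w_def using degree_prod_sum_le[OF insert.hyps(1), of "\<lambda>x. [:- x, 1:]"] by simp
  then have "degree b' \<le> card A"
    unfolding b'_def using b(2) by (intro degree_add_le degree_smult_le[THEN order_trans]) auto
  moreover have "poly b' x = v x" if "x \<in> insert z A" for x
    using that b(1) w[of x] w[of z] insert.hyps(2) by (auto simp: b'_def)
  ultimately show ?case using insert.hyps by (intro exI[of _ b']) simp
qed

lemma dvd_if_vanishing_on_roots:
  fixes f g :: "'a::field poly"
  assumes "degree f = card A" "degree f > 0"
    and "\<And>x. x \<in> A \<Longrightarrow> poly f x = 0" "\<And>x. x \<in> A \<Longrightarrow> poly g x = 0"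
  shows "f dvd g"
proof -
  have "degree (g mod f) < degree f"
    using degree_mod_less[of f g] assms(2) by (cases "f = 0") auto
  moreover have "poly (g mod f) x = 0" if "x \<in> A" for x
    using assms(3,4)[OF that] by (metis div_mult_mod_eq poly_add poly_mult mult_zero_right add_0)
  ultimately have "g mod f = 0"
    using assms(1,2) by (intro poly_eqI_degree[of A]) auto
  then show ?thesis by (simp add: dvd_eq_mod_eq_0)
qed

text \<open>
  The algebraic heart of the theorem: the numerator of the derivative of \<open>p / f'\<close> vanishes at all
  roots of \<open>f\<close> only if \<open>p / f'\<close> is constant.
\<close>

lemma smult_pderiv_if_vanishing:
  fixes f p :: "'a::field_char_0 poly"
  assumes n: "degree f = card A" "degree f > 0" and p: "degree p < degree f"
    and root: "\<And>x. x \<in> A \<Longrightarrow> poly f x = 0"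
    and simple: "\<And>x. x \<in> A \<Longrightarrow> poly (pderiv f) x \<noteq> 0"
    and van: "\<And>x. x \<in> A \<Longrightarrow> poly (pderiv p * pderiv f - p * pderiv (pderiv f)) x = 0"
  shows "\<exists>c. p = smult c (pderiv f)"
proof -
  have fin: "finite A" using n card_gt_0_iff by metis
  obtain b where b: "\<And>x. x \<in> A \<Longrightarrow> poly b x = poly p x / poly (pderiv f) x"
    and degb: "degree b \<le> degree f - 1"
    using ex_interpolating_poly[OF fin, of "\<lambda>x. poly p x / poly (pderiv f) x"] n by auto
  have bp: "poly b x * poly (pderiv f) x = poly p x" if "x \<in> A" for x
    using b[OF that] simple[OF that] by simp
  have "f dvd b * pderiv f - p"
    using n root bp by (intro dvd_if_vanishing_on_roots[of f A]) auto
  then obtain q where q: "b * pderiv f - p = f * q" by (elim dvdE)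
  have degq: "degree q < degree f"
  proof (cases "q = 0")
    case False
    then have "degree f + degree q = degree (b * pderiv f - p)"
      unfolding q using n(2) degree_mult_eq[of f q] by (cases "f = 0") auto
    also have "\<dots> \<le> (degree f - 1) + (degree f - 1)"
      using degree_mult_le[of b "pderiv f"] degb p
      by (intro degree_diff_le) (auto simp: degree_pderiv)
    finally show ?thesis using n by linarith
  qed (use n in auto)
  have "poly (pderiv b) x = poly q x" if x: "x \<in> A" for x
  proof -
    let ?f1 = "poly (pderiv f) x" and ?f2 = "poly (pderiv (pderiv f)) x"
    have "poly (pderiv (b * pderiv f - p)) x = poly (pderiv (f * q)) x" by (simp add: q)
    then have "poly b x * ?f2 + ?f1 * poly (pderiv b) x - poly (pderiv p) x = ?f1 * poly q x"
      using root[OF x] by (simp add: pderiv_mult pderiv_diff algebra_simps)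
    moreover have "poly (pderiv p) x * ?f1 = poly p x * ?f2"
      using van[OF x] by simp
    ultimately have "?f1 * (?f1 * poly (pderiv b) x) = ?f1 * (?f1 * poly q x)"
      using bp[OF x] by algebra
    then show ?thesis using simple[OF x] by simp
  qed
  then have "pderiv b = q"
    using n degb degq by (intro poly_eqI_degree[of A]) (auto simp: degree_pderiv)
  then have eq: "p = b * pderiv f - f * pderiv b" using q by (simp add: algebra_simps)
  \<comment> \<open>Compare the coefficients of degree \<open>degree f + degree b - 1\<close>.\<close>
  have "degree b = 0"
  proof (rule ccontr)
    assume d: "degree b \<noteq> 0"
    have "coeff (b * pderiv f) (degree b + degree (pderiv f)) = lead_coeff b * (of_nat (degree f) * lead_coeff f)"
      using n unfolding coeff_mult_degree_sum by (simp add: degree_pderiv coeff_pderiv)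
    moreover have "coeff (f * pderiv b) (degree f + degree (pderiv b)) = lead_coeff f * (of_nat (degree b) * lead_coeff b)"
      using d unfolding coeff_mult_degree_sum by (simp add: degree_pderiv coeff_pderiv)
    moreover have "degree b + degree (pderiv f) = degree f + degree (pderiv b)"
      using n d by (simp add: degree_pderiv)
    moreover have "coeff p (degree f + degree (pderiv b)) = 0"
      using p by (intro coeff_eq_0) simp
    ultimately have "of_nat (degree f) * (lead_coeff b * lead_coeff f) = of_nat (degree b) * (lead_coeff b * lead_coeff f)"
      by (subst (asm) eq) (simp add: algebra_simps)
    moreover have "b \<noteq> 0" "f \<noteq> 0" using d n by auto
    ultimately have "degree f = degree b" by simp
    with degb n show False by simp
  qed
  then obtain c where "b = [:c:]" by (elim degree_eq_zeroE)
  with eq show ?thesis by auto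
qed

section \<open>The differential of the root derivatives\<close>

lemma poly_pderiv_poly_of_coords:
  "poly (pderiv (poly_of_coords c)) x =
     (\<Sum>i\<in>UNIV. of_nat (coord_index i) * c $ i * x ^ (coord_index i - 1))"
  by (simp add: poly_of_coords_def pderiv_sum_poly pderiv_monom poly_sum poly_monom mult_ac)

lemma poly_pderiv2_monic_of_coords:
  "poly (pderiv (pderiv (monic_of_coords (a :: complex ^ 'n)))) x =
     of_nat CARD('n) * (of_nat (CARD('n) - 1) * x ^ (CARD('n) - 1 - 1)) +
     (\<Sum>i\<in>UNIV. of_nat (coord_index i) * a $ i * (of_nat (coord_index i - 1) * x ^ (coord_index i - 1 - 1)))"
  by (simp add: monic_of_coords_def poly_of_coords_def pderiv_add pderiv_sum_poly pderiv_monom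
      poly_sum poly_monom mult_ac)

lemma poly_pderiv_monic_has_derivative:
  fixes p :: "(complex ^ 'n) \<times> complex"
  shows "((\<lambda>p. poly (pderiv (monic_of_coords (fst p))) (snd p)) has_derivative
     (\<lambda>h. poly (pderiv (pderiv (monic_of_coords (fst p)))) (snd p) * snd h
           + poly (pderiv (poly_of_coords (fst h))) (snd p))) (at p)"
  unfolding poly_pderiv_monic_of_coords poly_pderiv2_monic_of_coords poly_pderiv_poly_of_coords
  apply (rule has_derivative_eq_rhs)
   apply (rule derivative_eq_intros refl bounded_linear.has_derivative[OF bounded_linear_vec_nth])+
  apply (auto simp: fun_eq_iff algebra_simps sum.distrib sum_distrib_left simp del: of_nat_diff)
  done

lemma has_derivative_vec_lambda:
  fixes F :: "'n::finite \<Rightarrow> 'a::real_normed_vector \<Rightarrow> 'b::euclidean_space"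
  assumes "\<And>i. (F i has_derivative F' i) (at a)"
  shows "((\<lambda>x. \<chi> i. F i x) has_derivative (\<lambda>h. \<chi> i. F' i h)) (at a)"
proof -
  have "((\<lambda>x. \<Sum>i\<in>UNIV. axis i (F i x)) has_derivative (\<lambda>h. \<Sum>i\<in>UNIV. axis i (F' i h))) (at a)"
  proof (intro has_derivative_sum)
    fix i :: 'n
    have "linear (axis i :: 'b \<Rightarrow> 'b ^ 'n)"
      by (rule linearI) (auto simp: axis_def vec_eq_iff)
    then have "bounded_linear (axis i :: 'b \<Rightarrow> 'b ^ 'n)"
      by (simp add: linear_conv_bounded_linear)
    from bounded_linear.has_derivative[OF this assms[of i]]
    show "((\<lambda>x. axis i (F i x) :: 'b ^ 'n) has_derivative (\<lambda>h. axis i (F' i h))) (at a)" .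
  qed
  moreover have "(\<Sum>i\<in>UNIV. axis i (x i)) = (\<chi> i. x i)" for x :: "'n \<Rightarrow> 'b"
    by (simp add: vec_eq_iff axis_def)
  ultimately show ?thesis by simp
qed

text \<open>
  For \<open>p = poly_of_coords h\<close> and a root \<open>\<alpha>\<^sub>i\<close> of \<open>f\<close>, the term \<open>p'(\<alpha>\<^sub>i)\<close> comes from varying \<open>f\<close> at a
  fixed point, and the second term from moving that point at the speed \<open>- p(\<alpha>\<^sub>i) / f'(\<alpha>\<^sub>i)\<close>.
\<close>

lemma root_deriv_map_has_derivative:
  fixes \<alpha> :: "complex ^ 'n \<Rightarrow> complex ^ 'n"
  assumes ord: "local_root_ordering U \<alpha>" and a: "a \<in> U"
  shows "(root_deriv_map \<alpha> has_derivative (\<lambda>h. \<chi> i.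
           poly (pderiv (poly_of_coords h)) (\<alpha> a $ i) -
           poly (pderiv (pderiv (monic_of_coords a))) (\<alpha> a $ i) *
             poly (poly_of_coords h) (\<alpha> a $ i) / poly (pderiv (monic_of_coords a)) (\<alpha> a $ i))) (at a)"
  (is "(_ has_derivative ?dM) _")
proof -
  let ?f = "monic_of_coords a"
  obtain D where D: "(\<alpha> has_derivative D) (at a)"
    using ord a unfolding local_root_ordering_def holomorphic_map_on_def by blast
  have root: "poly (monic_of_coords b) (\<alpha> b $ i) = 0" if "b \<in> U" for b i
    using ord that bij_betw_apply[of "\<lambda>i. \<alpha> b $ i" UNIV _ i] by (auto simp: local_root_ordering_def)
  have "rsquarefree ?f"
    using ord a by (auto simp: local_root_ordering_def P_space_def)
  then have simple: "poly (pderiv ?f) (\<alpha> a $ i) \<noteq> 0" for i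
    using root[OF a] rsquarefree_roots by blast
  have dpair: "((\<lambda>b. (b, \<alpha> b $ i)) has_derivative (\<lambda>h. (h, D h $ i))) (at a)" for i
    by (intro has_derivative_Pair has_derivative_ident
        bounded_linear.has_derivative[OF bounded_linear_vec_nth D])
  \<comment> \<open>Implicit differentiation of \<open>f(\<alpha>\<^sub>i) = 0\<close>.\<close>
  have Di: "D h $ i = - poly (poly_of_coords h) (\<alpha> a $ i) / poly (pderiv ?f) (\<alpha> a $ i)" for h i
  proof -
    from has_derivative_compose[OF dpair[of i], where g="\<lambda>p. poly (monic_of_coords (fst p)) (snd p)",
        OF poly_monic_has_derivative]
    have "((\<lambda>b. poly (monic_of_coords b) (\<alpha> b $ i)) has_derivative
       (\<lambda>h. poly (pderiv ?f) (\<alpha> a $ i) * D h $ i + poly (poly_of_coords h) (\<alpha> a $ i))) (at a)"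
      by simp
    moreover have "((\<lambda>b. poly (monic_of_coords b) (\<alpha> b $ i)) has_derivative (\<lambda>h. 0)) (at a)"
      using ord root
      by (intro has_derivative_transform_within_open[OF has_derivative_const[of 0] _ a])
        (auto simp: local_root_ordering_def)
    ultimately have "(\<lambda>h. poly (pderiv ?f) (\<alpha> a $ i) * D h $ i + poly (poly_of_coords h) (\<alpha> a $ i)) = (\<lambda>h. 0)"
      by (rule has_derivative_unique)
    then have "poly (pderiv ?f) (\<alpha> a $ i) * D h $ i = - poly (poly_of_coords h) (\<alpha> a $ i)"
      by (metis eq_neg_iff_add_eq_0)
    then show ?thesis using simple[of i] by (simp add: field_simps)
  qed
  have "((\<lambda>b. poly (pderiv (monic_of_coords b)) (\<alpha> b $ i)) has_derivative (\<lambda>h. ?dM h $ i)) (at a)" for i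
    using has_derivative_compose[OF dpair[of i],
        where g="\<lambda>p. poly (pderiv (monic_of_coords (fst p))) (snd p)",
        OF poly_pderiv_monic_has_derivative]
    by (simp add: Di algebra_simps)
  from has_derivative_vec_lambda[OF this] show ?thesis
    by (simp add: root_deriv_map_def[abs_def])
qed

section \<open>Rank of a linear map whose kernel is a line\<close>

text \<open>
  Rank and nullity for a kernel of dimension one: a basis that extends \<open>k\<close> gives a complement of the
  kernel, which the map sends isomorphically onto its range.
\<close>

lemma dim_range_if_kernel_line:
  fixes D :: "'a::field ^ 'n \<Rightarrow> 'a ^ 'm"
  assumes D: "Vector_Spaces.linear (*s) (*s) D"
    and ker: "{v. D v = 0} = vec.span {k}" and "k \<noteq> 0"
  shows "vec.dim (range D) = CARD('n) - 1"
proof -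
  interpret D: Vector_Spaces.linear "(*s)" "(*s)" D by (rule D)
  have "vec.independent {k}" using \<open>k \<noteq> 0\<close> by simp
  then obtain B where B: "{k} \<subseteq> B" "vec.independent B" "UNIV \<subseteq> vec.span B"
    using vec.maximal_independent_subset_extend[of "{k}" UNIV] by auto
  have "card B = CARD('n)"
    using vec.basis_card_eq_dim[OF _ B(3,2)] vec_dim_card[where 'a='a and 'n='n] by simp
  then have cC: "card (B - {k}) = CARD('n) - 1"
    using B(1) by (simp add: card_Diff_singleton)
  define S where "S = vec.span (B - {k})"
  have kS: "k \<notin> S" using B(1,2) by (auto simp: vec.dependent_def S_def)
  have kcases: "\<exists>c. x = c *s k" if "D x = 0" for x
    using that ker by (auto simp: vec.span_singleton)
  have Dk: "D (c *s k) = 0" for c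
    using ker by (auto simp: vec.span_singleton)
  have "inj_on D (vec.span S)"
  proof -
    have "x = 0" if x: "x \<in> S" "D x = 0" for x
    proof (rule ccontr)
      assume "x \<noteq> 0"
      moreover obtain c where c: "x = c *s k" using kcases x(2) by blast
      ultimately have "k = inverse c *s x" by auto
      then show False using kS x(1) by (metis S_def vec.span_scale)
    qed
    then show ?thesis
      by (subst D.inj_on_iff_eq_0) (auto simp: S_def vec.span_span)
  qed
  then have "vec.dim (D ` S) = vec.dim S"
    using vec.dim_image_eq[OF D] by blast
  moreover have "range D = D ` S"
  proof -
    have "D x \<in> D ` S" for x
    proof -
      have "x \<in> vec.span (insert k (B - {k}))" using B by (auto simp: insert_absorb)
      then obtain c where "x - c *s k \<in> S" unfolding S_def vec.span_breakdown_eq by blast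
      moreover have "D x = D (x - c *s k)" by (simp add: D.diff Dk)
      ultimately show ?thesis by blast
    qed
    then show ?thesis by auto
  qed
  moreover have "vec.dim S = CARD('n) - 1"
    unfolding S_def vec.dim_span cC[symmetric]
    using B(2) by (intro vec.dim_eq_card_independent vec.independent_mono[OF B(2)]) auto
  ultimately show ?thesis by simp
qed

section \<open>Kernel and rank of the tangent map\<close>

theorem theorem1p1:
  fixes f :: "complex poly"
    and U :: "(complex ^ 'n) set"
    and \<alpha> :: "complex ^ 'n \<Rightarrow> complex ^ 'n"
  assumes "CARD('n) \<ge> 2"
    and "f \<in> P_space CARD('n)"
    and "local_root_ordering U \<alpha>"
    and "coords f \<in> U"
  shows "let dM = tangent_map \<alpha> (coords f);
             K = {p. degree p \<le> CARD('n) - 1 \<and> dM (coords p) = 0}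
         in (root_deriv_map \<alpha> has_derivative dM) (at (coords f)) \<and>
            Vector_Spaces.linear (*s) (*s) dM \<and>
            vec.dim (range dM) = CARD('n) - 1 \<and>
            pderiv f \<in> K \<and>
            K = range (\<lambda>c. smult c (pderiv f)) \<and>
            vec.dim {v. dM v = 0} = 1"
proof -
  let ?n = "CARD('n)"
  define a where "a = (coords f :: complex ^ 'n)"
  define dM where "dM = tangent_map \<alpha> a"
  define K where "K = {p. degree p \<le> ?n - 1 \<and> dM (coords p) = 0}"
  have fa: "monic_of_coords a = f"
    unfolding a_def by (rule monic_of_coords_coords[OF assms(2)])
  have degf: "degree f = ?n" and sf: "rsquarefree f"
    using assms(2) by (auto simp: P_space_def)
  have bij: "bij_betw (\<lambda>i. \<alpha> a $ i) UNIV {x. poly f x = 0}"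
    using assms(3,4) fa by (auto simp: local_root_ordering_def a_def)
  have simple: "poly (pderiv f) x \<noteq> 0" if "poly f x = 0" for x
    using sf that rsquarefree_roots by blast
  have root: "poly f (\<alpha> a $ i) = 0" for i
    using bij by (auto simp: bij_betw_def)
  have cardR: "degree f = card {x. poly f x = 0}"
    using bij_betw_same_card[OF bij] degf by simp
  define E :: "complex ^ 'n \<Rightarrow> complex ^ 'n" where "E h = (\<chi> i.
           poly (pderiv (poly_of_coords h)) (\<alpha> a $ i) -
           poly (pderiv (pderiv f)) (\<alpha> a $ i) *
             poly (poly_of_coords h) (\<alpha> a $ i) / poly (pderiv f) (\<alpha> a $ i))" for h
  have der: "(root_deriv_map \<alpha> has_derivative E) (at a)"
    using root_deriv_map_has_derivative[OF assms(3,4)] unfolding E_def[abs_def] a_def[symmetric] fa .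
  have dME: "dM = E"
    unfolding dM_def tangent_map_def by (rule frechet_derivative_at[OF der, symmetric])
  have lin: "Vector_Spaces.linear (*s) (*s) E"
    by unfold_locales
      (auto simp: E_def vec_eq_iff poly_poly_of_coords poly_pderiv_poly_of_coords algebra_simps
        sum.distrib add_divide_distrib diff_divide_distrib sum_distrib_left)
  have E0: "E (coords p) = 0 \<longleftrightarrow>
      (\<forall>x. poly f x = 0 \<longrightarrow> poly (pderiv p * pderiv f - p * pderiv (pderiv f)) x = 0)"
    if "degree p < ?n" for p
  proof -
    have "E (coords p) = 0 \<longleftrightarrow>
      (\<forall>i. poly (pderiv p * pderiv f - p * pderiv (pderiv f)) (\<alpha> a $ i) = 0)"
      using simple[OF root] that by (simp add: E_def vec_eq_iff poly_of_coords_coords field_simps)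
    also have "\<dots> \<longleftrightarrow> (\<forall>x\<in>range (\<lambda>i. \<alpha> a $ i). poly (pderiv p * pderiv f - p * pderiv (pderiv f)) x = 0)"
      by blast
    also have "range (\<lambda>i. \<alpha> a $ i) = {x. poly f x = 0}"
      using bij by (simp add: bij_betw_def)
    finally show ?thesis by simp
  qed
  have degp: "degree (pderiv f) < ?n" using degf assms(1) by (simp add: degree_pderiv)
  have Kmem: "p \<in> K \<longleftrightarrow> degree p < ?n \<and> E (coords p) = 0" for p
    using assms(1) by (auto simp: K_def dME)
  have K: "K = range (\<lambda>c. smult c (pderiv f))"
  proof (intro set_eqI iffI)
    fix p assume "p \<in> K"
    then have "\<exists>c. p = smult c (pderiv f)"
      using E0[of p] cardR degf simple assms(1)
      by (intro smult_pderiv_if_vanishing[of f "{x. poly f x = 0}"]) (auto simp: Kmem)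
    then show "p \<in> range (\<lambda>c. smult c (pderiv f))" by blast
  next
    fix p assume "p \<in> range (\<lambda>c. smult c (pderiv f))"
    then obtain c where p: "p = smult c (pderiv f)" by blast
    then have "degree p < ?n" using degp by (simp add: degree_smult_eq)
    moreover from this have "E (coords p) = 0"
      unfolding E0[OF \<open>degree p < ?n\<close>] by (simp add: p pderiv_smult)
    ultimately show "p \<in> K" by (simp add: Kmem)
  qed
  define k where "k = (coords (pderiv f) :: complex ^ 'n)"
  have "pderiv f \<noteq> 0" using degf assms(1) by (simp add: pderiv_eq_0_iff)
  then have k0: "k \<noteq> 0"
    using poly_of_coords_coords[OF degp] by (auto simp: k_def poly_of_coords_def)
  have ker: "{v. E v = 0} = vec.span {k}"
  proof -
    have "E v = 0 \<longleftrightarrow> (\<exists>c. v = c *s k)" for v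
    proof -
      have d: "degree (poly_of_coords v) < ?n"
        by (rule degree_lessI) (auto simp: coeff_poly_of_coords_ge)
      have "E v = 0 \<longleftrightarrow> poly_of_coords v \<in> K" using d by (simp add: Kmem)
      also have "\<dots> \<longleftrightarrow> (\<exists>c. poly_of_coords v = smult c (pderiv f))" by (auto simp: K)
      also have "\<dots> \<longleftrightarrow> (\<exists>c. v = c *s k)"
      proof -
        have ck: "coords (smult c (pderiv f)) = c *s k" for c
          by (simp add: coords_def k_def vec_eq_iff)
        have "poly_of_coords v = smult c (pderiv f) \<longleftrightarrow> v = c *s k" for c
          using degp ck[of c] poly_of_coords_coords[of "smult c (pderiv f)", where 'n='n]
          by (metis coords_poly_of_coords degree_smult_le le_less_trans)
        then show ?thesis by simp
      qed
      finally show ?thesis .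
    qed
    then show ?thesis by (auto simp: vec.span_singleton)
  qed
  have "vec.dim (range E) = ?n - 1" by (rule dim_range_if_kernel_line[OF lin ker k0])
  moreover have "vec.dim {v. E v = 0} = 1" using k0 by (simp add: ker)
  moreover have "pderiv f \<in> K" unfolding K by (rule range_eqI[of _ _ 1]) simp
  ultimately show ?thesis
    using der lin K
    unfolding Let_def a_def[symmetric] dM_def[symmetric] K_def[symmetric] dME[symmetric] by blast
qed

end
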